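(* For each integer $k\geq 2$, $\mathcal{W}(\mathbf{\Pi}^0_k) \leq \mathcal{W}(\mathbf{\Pi}^0_{k+1})$; that is, there is a continuous function $H : 2^{2^\star} \to 2^{2^\star}$ such that $\mathcal{W}(\mathbf{\Pi}^0_k) = H^{-1}(\mathcal{W}(\mathbf{\Pi}^0_{k+1}))$.
   Context: Let $2=\{0,1\}$ be the two-letter alphabet, $2^\star$ the set of finite words over it (including the empty word $\lambda$), and $2^\omega$ the set of infinite words over it, equipped with the Cantor topology (product of discrete topologies). A dictionary is a subset $V \subseteq 2^\star$; its $\omega$-power is $V^\omega = \{u_1\cdot u_2\cdots u_n\cdots \mid \forall i\geq 1,\ u_i \in V\setminus\{\lambda\}\} \subseteq 2^\omega$. Dictionaries are identified with their characteristic functions, i.e. with elements of the space $2^{2^\star}$ of functions $2^\star\to\{0,1\}$, equipped with the product topology of the discrete topology on $\{0,1\}$ (so it is homeomorphic to the Cantor space). Borel classes on $2^\omega$: $\mathbf{\Sigma}^0_1$ is the class of open sets, $\mathbf{\Pi}^0_1$ the class of closed sets, and for $k\geq 2$, $\mathbf{\Sigma}^0_k$ (respectively $\mathbf{\Pi}^0_k$) is the class of countable unions (respectively countable intersections) of sets in $\bigcup_{j<k}\mathbf{\Pi}^0_j$ (respectively $\bigcup_{j<k}\mathbf{\Sigma}^0_j$). Define $\mathcal{W}(\mathbf{\Pi}^0_k) = \{A\subseteq 2^\star \mid A^\omega \text{ is a } \mathbf{\Pi}^0_k\text{-subset of } 2^\omega\}$. For $\mathcal{A},\mathcal{B}\subseteq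 2^{2^\star}$, $\mathcal{A}\leq \mathcal{B}$ means that there is a continuous function $H:2^{2^\star}\to 2^{2^\star}$ with $\mathcal{A}=H^{-1}(\mathcal{B})$. *)

theory Defs
  imports "HOL-Analysis.Analysis" "HOL-Library.Stream"
begin

text \<open>
  The alphabet \<open>{0,1}\<close> is \<^typ>\<open>bool\<close>, which is an instance of \<^class>\<open>discrete_topology\<close>.  On
  both \<^typ>\<open>nat \<Rightarrow> bool\<close> (infinite words) and \<^typ>\<open>bool list \<Rightarrow> bool\<close> (dictionaries) the topology is
  the product topology of the function-space instance from Function_Topology.
\<close>

type_synonym word = "bool list"
type_synonym omega_word = "nat \<Rightarrow> bool"
type_synonym dictionary = "word \<Rightarrow> bool"

text \<open>
  Since the empty word is excluded, \<^const>\<open>flat\<close> is applied only to streams of nonempty words,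
  where it is the genuine infinite concatenation.
\<close>

definition omega_power :: "word set \<Rightarrow> omega_word set" where
  "omega_power V = {snth (flat us) | us. us \<in> streams (V - {[]})}"

text \<open>The index 0 is not used: no set satisfies \<open>Sigma0 0\<close> or \<open>Pi0 0\<close>.\<close>

inductive
  Sigma0 :: "nat \<Rightarrow> 'a::topological_space set \<Rightarrow> bool"
  and Pi0 :: "nat \<Rightarrow> 'a::topological_space set \<Rightarrow> bool"
where
  Sigma0_open: "open U \<Longrightarrow> Sigma0 1 U"
| Pi0_closed: "closed C \<Longrightarrow> Pi0 1 C"
| Sigma0_UN: "\<lbrakk>k \<ge> 2; \<And>n::nat. \<exists>j\<ge>1. j < k \<and> Pi0 j (F n)\<rbrakk> \<Longrightarrow> Sigma0 k (\<Union>n. F n)"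
| Pi0_INT: "\<lbrakk>k \<ge> 2; \<And>n::nat. \<exists>j\<ge>1. j < k \<and> Sigma0 j (F n)\<rbrakk> \<Longrightarrow> Pi0 k (\<Inter>n. F n)"

definition dict_class :: "(omega_word set \<Rightarrow> bool) \<Rightarrow> dictionary set" ("\<W>") where
  "\<W> \<Gamma> = {A. \<Gamma> (omega_power {w. A w})}"

definition reducible :: "dictionary set \<Rightarrow> dictionary set \<Rightarrow> bool" (infix "\<le>\<^sub>W" 50) where
  "\<A> \<le>\<^sub>W \<B> \<longleftrightarrow> (\<exists>H :: dictionary \<Rightarrow> dictionary. continuous_on UNIV H \<and> \<A> = H -` \<B>)"

end

theory Submission
  imports Defs
begin

text \<open>
  A binary word of even length is read, two bits at a time, as a program for a stack: \<open>00\<close> and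
  \<open>01\<close> push the letters 0 and 1, while \<open>10\<close> and \<open>11\<close> both pop the top letter.  The reduction sends
  a dictionary \<open>A\<close> to the dictionary of all programs that, started on the empty stack, never
  underflow and end with a nonempty word of \<open>A\<close> on the stack (\<open>stack_dictionary\<close>).  Whether a given
  word belongs to it depends on finitely many values of \<open>A\<close>, so the map is continuous.

  An infinite program \<^emph>\<open>settles\<close> to the infinite word \<open>y\<close> if it never underflows, its stack height
  tends to infinity, and \<open>y\<close> is the sequence of letters that are pushed and never popped again.
  A factor which leaves a word of \<open>A\<close> on top of the stack, and never goes below its initial height,
  can be concatenated with such factors, and conversely a settling program can be cut at the last
  time when the height has a given value.  Hence the \<open>\<omega>\<close>-power of the new dictionary is the set of
  programs that settle to an element of \<open>A\<^sup>\<omega>\<close> (\<open>omega_power_stack_dictionary\<close>).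

  If \<open>A\<^sup>\<omega>\<close> is \<open>\<Pi>\<^sup>0\<^sub>k\<close>, then the new \<open>\<omega>\<close>-power is \<open>\<Pi>\<^sup>0\<^sub>k\<^sub>+\<^sub>1\<close>: the limit of a program is a
  function of the first Baire class, so that preimages climb one class
  (\<open>limit_preimage_Pi0\<close>), and its domain is \<open>\<Pi>\<^sup>0\<^sub>3\<close> (\<open>Pi0_3_settles\<close>).  The latter is harmless because
  \<open>k \<ge> 2\<close>.

  For the converse, a set whose preimage under the limit is \<open>\<Pi>\<^sup>0\<^sub>k\<^sub>+\<^sub>1\<close> has to be shown \<open>\<Pi>\<^sup>0\<^sub>k\<close>.  The
  programs that settle to \<open>y\<close> include those of the form \<open>d\<^sub>0 y\<^sub>0 d\<^sub>1 y\<^sub>1 \<dots>\<close>, where the gaps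
  \<open>d\<^sub>i\<close> are programs that leave no trace; the gaps can be chosen freely, independently of \<open>y\<close>.  So
  one can take the Vaught transform along the sequence of gaps, that is, ask whether a generic
  sequence of gaps gives a program in \<open>B\<close>.  This is the induction \<open>generic_membership_Sigma0\<close>.  It
  gains one class at its bottom level: for a closed set \<open>F\<close>, whether all gap sequences with a
  given beginning of length \<open>m\<close> give a program in \<open>F\<close> depends only on the first \<open>m\<close> letters of \<open>y\<close>,
  which is an open condition.  The reason is that the next gap may first imitate any program of any
  other limit for as long as one likes, and then erase what it has written
  (\<open>program_forcing_transfer\<close>).
\<close>

section \<open>Borel classes\<close>

lemma
  fixes A B :: "'a::topological_space set"
  shows Sigma0_imp_Pi0_Compl: "Sigma0 k A \<Longrightarrow> Pi0 k (- A)"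
    and Pi0_imp_Sigma0_Compl: "Pi0 l B \<Longrightarrow> Sigma0 l (- B)"
proof (induction rule: Sigma0_Pi0.inducts)
  case (Sigma0_open U)
  then show ?case by (intro Pi0_closed) (simp add: closed_Compl)
next
  case (Pi0_closed C)
  then show ?case by (intro Sigma0_open) (simp add: open_Compl)
next
  case (Sigma0_UN k F)
  have "Pi0 k (\<Inter>n. - F n)"
    using Sigma0_UN by (intro Pi0_INT) metis+
  then show ?case by (simp add: Compl_UN)
next
  case (Pi0_INT k F)
  have "Sigma0 k (\<Union>n. - F n)"
    using Pi0_INT by (intro Sigma0_UN) metis+
  then show ?case by (simp add: Compl_INT)
qed

lemma Sigma0_Compl: "Sigma0 k (- A) \<longleftrightarrow> Pi0 k A"
  using Sigma0_imp_Pi0_Compl[of k "- A"] Pi0_imp_Sigma0_Compl[of k A]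
  unfolding double_complement by blast

lemma Pi0_Compl: "Pi0 k (- A) \<longleftrightarrow> Sigma0 k A"
  using Sigma0_Compl[of k "- A"] by simp

lemma Sigma0_1_iff: "Sigma0 1 U \<longleftrightarrow> open U"
proof
  assume "Sigma0 1 U"
  then show "open U" by cases auto
qed (rule Sigma0_open)

lemma Pi0_1_iff: "Pi0 1 U \<longleftrightarrow> closed U"
proof
  assume "Pi0 1 U"
  then show "closed U" by cases auto
qed (rule Pi0_closed)

lemma Sigma0_UN_E:
  assumes "Sigma0 k A" "k \<ge> 2"
  obtains F :: "nat \<Rightarrow> 'a::topological_space set"
    where "A = (\<Union>n. F n)" "\<And>n. \<exists>j\<ge>1. j < k \<and> Pi0 j (F n)"
  using assms(1)
proof cases
  case Sigma0_open
  then show ?thesis using assms(2) by simp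
next
  case (Sigma0_UN F)
  then show ?thesis using that by blast
qed

lemma UN_from_nat: "(\<Union>n. F (from_nat n)) = (\<Union>i::'i::countable. F i)"
  by (metis image_image surj_from_nat)

lemma Sigma0_Suc_Union_Pi0:
  fixes F :: "'i::countable \<Rightarrow> 'a::topological_space set"
  assumes "k \<ge> 1" "\<And>i. Pi0 k (F i)"
  shows "Sigma0 (Suc k) (\<Union>i. F i)"
proof -
  have "Sigma0 (Suc k) (\<Union>n. F (from_nat n))"
    using assms by (intro Sigma0_UN) auto
  then show ?thesis by (simp only: UN_from_nat)
qed

lemma Sigma0_Union:
  fixes A :: "'i::countable \<Rightarrow> 'a::topological_space set"
  assumes k: "k \<ge> 1" and A: "\<And>i. Sigma0 k (A i)"
  shows "Sigma0 k (\<Union>i. A i)"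
proof (cases "k = 1")
  case True
  then show ?thesis using A by (simp add: Sigma0_1_iff[simplified] open_UN)
next
  case False
  with k have k2: "k \<ge> 2" by simp
  have "\<exists>F. A i = (\<Union>n. F n) \<and> (\<forall>n::nat. \<exists>j\<ge>1. j < k \<and> Pi0 j (F n))" for i
    by (rule Sigma0_UN_E[OF A[of i] k2]) blast
  then obtain F where AF: "\<And>i. A i = (\<Union>n. F i n)"
    and F: "\<And>i n. \<exists>j\<ge>1. j < k \<and> Pi0 j (F i (n::nat))"
    by metis
  let ?G = "\<lambda>p::'i \<times> nat. F (fst p) (snd p)"
  have "Sigma0 k (\<Union>n. ?G (from_nat n))"
    using k2 F by (intro Sigma0_UN) auto
  moreover have "(\<Union>n. ?G (from_nat n)) = (\<Union>p. ?G p)"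
    by (rule UN_from_nat)
  moreover have "(\<Union>p. ?G p) = (\<Union>i. A i)"
    unfolding AF by force
  ultimately show ?thesis by simp
qed

lemma Pi0_Inter:
  fixes A :: "'i::countable \<Rightarrow> 'a::topological_space set"
  assumes "k \<ge> 1" "\<And>i. Pi0 k (A i)"
  shows "Pi0 k (\<Inter>i. A i)"
proof -
  have "Sigma0 k (\<Union>i. - A i)"
    using assms by (intro Sigma0_Union) (simp_all add: Sigma0_Compl)
  then show ?thesis by (metis Compl_INT Sigma0_Compl)
qed

lemma Pi0_Int:
  assumes "k \<ge> 1" "Pi0 k A" "Pi0 k B"
  shows "Pi0 k (A \<inter> B)"
proof -
  have "Pi0 k (\<Inter>b. if b then A else B)"
    using assms by (intro Pi0_Inter) auto
  moreover have "(\<Inter>b. if b then A else B) = A \<inter> B"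
    by (auto split: if_splits)
  ultimately show ?thesis by simp
qed

lemma Pi0_Suc_Inter_Sigma0:
  fixes F :: "'i::countable \<Rightarrow> 'a::topological_space set"
  assumes "k \<ge> 1" "\<And>i. Sigma0 k (F i)"
  shows "Pi0 (Suc k) (\<Inter>i. F i)"
proof -
  have "Sigma0 (Suc k) (\<Union>i. - F i)"
    using assms by (intro Sigma0_Suc_Union_Pi0) (simp_all add: Pi0_Compl)
  then show ?thesis by (metis Compl_INT Sigma0_Compl)
qed

section \<open>The topology of the space of infinite words\<close>

lemma open_finitely_determined:
  fixes S :: "omega_word set"
  assumes "\<And>x y. x \<in> S \<Longrightarrow> (\<forall>i<n. y i = x i) \<Longrightarrow> y \<in> S"
  shows "open S"
proof (subst open_subopen, intro ballI)
  fix x assume x: "x \<in> S"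
  have "open ((\<lambda>y::omega_word. y i) -` {x i})" for i
    by (intro open_vimage open_discrete continuous_on_product_coordinates)
  then have "open (\<Inter>i\<in>{..<n}. (\<lambda>y::omega_word. y i) -` {x i})"
    by (intro open_INT) auto
  moreover have "(\<Inter>i\<in>{..<n}. (\<lambda>y::omega_word. y i) -` {x i}) \<subseteq> S"
    using assms[OF x] by auto
  ultimately show "\<exists>T. open T \<and> x \<in> T \<and> T \<subseteq> S"
    by (intro exI[of _ "\<Inter>i\<in>{..<n}. (\<lambda>y::omega_word. y i) -` {x i}"]) auto
qed

lemma closed_finitely_determined:
  fixes S :: "omega_word set"
  assumes "\<And>x y. x \<in> S \<Longrightarrow> (\<forall>i<n. y i = x i) \<Longrightarrow> y \<in> S"
  shows "closed S"
  unfolding closed_def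
proof (rule open_finitely_determined[where n = n])
  fix x y assume "x \<in> - S" "\<forall>i<n. y i = x i"
  then show "y \<in> - S" using assms[of y x] by auto
qed

lemma open_contains_cylinder:
  fixes U :: "omega_word set"
  assumes "open U" "x \<in> U"
  obtains n where "\<And>y. \<forall>i<n. y i = x i \<Longrightarrow> y \<in> U"
proof -
  obtain X where X: "x \<in> Pi\<^sub>E UNIV X" "finite {i. X i \<noteq> UNIV}" "Pi\<^sub>E UNIV X \<subseteq> U"
    using product_topology_open_contains_basis[of "\<lambda>_. euclidean" UNIV U x] assms
    unfolding open_fun_def by auto
  then obtain n where n: "\<And>i. X i \<noteq> UNIV \<Longrightarrow> i < n"
    using finite_nat_bounded[OF X(2)] by blast
  have "y \<in> U" if y: "\<forall>i<n. y i = x i" for y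
  proof -
    have "y i \<in> X i" for i
      using X(1) y n[of i] by (cases "X i = UNIV") (auto simp: PiE_iff)
    then show ?thesis using X(3) by (auto simp: PiE_iff)
  qed
  then show ?thesis using that by blast
qed

text \<open>
  Cylinders are clopen, so an open set is the union of the closed sets of those words whose cylinder
  of length \<open>n\<close> it contains.  In an arbitrary topological space open sets need not be \<open>\<Sigma>\<^sup>0\<^sub>2\<close>, and
  for this reason monotonicity of the classes is stated for infinite words only.
\<close>

lemma Sigma0_2_open:
  fixes U :: "omega_word set"
  assumes "open U"
  shows "Sigma0 2 U"
proof -
  let ?C = "\<lambda>n. {x. \<forall>y. (\<forall>i<n. y i = x i) \<longrightarrow> y \<in> U}"
  have "closed (?C n)" for n
    by (rule closed_finitely_determined[where n = n]) auto
  then have "Sigma0 (Suc 1) (\<Union>n. ?C n)"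
    by (intro Sigma0_Suc_Union_Pi0) (auto simp: Pi0_1_iff[simplified])
  moreover have "(\<Union>n. ?C n) = U"
  proof (intro equalityI subsetI)
    fix x assume "x \<in> U"
    then show "x \<in> (\<Union>n. ?C n)"
      by (rule open_contains_cylinder[OF assms]) blast
  qed blast
  ultimately show ?thesis by (simp add: numeral_2_eq_2)
qed

lemma Sigma0_mono:
  fixes A :: "omega_word set"
  assumes "Sigma0 j A" "j \<le> k" "k \<ge> 2" "j \<ge> 1"
  shows "Sigma0 k A"
proof -
  have "Sigma0 k A" if "Sigma0 j A" "2 \<le> j" "j \<le> k" for j
    using Sigma0_UN_E[OF that(1,2)] that(3)
    by (metis Sigma0_UN assms(3) order_less_le_trans)
  then show ?thesis
    using assms Sigma0_2_open[of A] Sigma0_1_iff[of A]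
    by (metis One_nat_def Suc_leI le_neq_implies_less numeral_2_eq_2 order_refl)
qed

section \<open>Generic sequences\<close>

text \<open>
  Comeagerness in the product \<open>'a\<^sup>\<nat>\<close> of discrete spaces.  The set \<open>G n\<close> of finite sequences
  stands for the dense open set of all infinite sequences that have a beginning in \<open>G n\<close>.
\<close>

definition generically :: "((nat \<Rightarrow> 'a) \<Rightarrow> bool) \<Rightarrow> bool" where
  "generically P \<longleftrightarrow> (\<exists>G :: nat \<Rightarrow> 'a list set. (\<forall>n u. \<exists>v. u @ v \<in> G n) \<and>
     (\<forall>d. (\<forall>n. \<exists>m. map d [0..<m] \<in> G n) \<longrightarrow> P d))"

lemma initial_append: "m \<le> n \<Longrightarrow> map d [0..<n] = map d [0..<m] @ map d [m..<n]"
  using upt_add_eq_append[of 0 m "n - m"] by simp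

lemma generically_meets_dense:
  assumes "\<And>u. \<exists>v. u @ v \<in> G"
  shows "generically (\<lambda>d. \<exists>m. map d [0..<m] \<in> G)"
  unfolding generically_def using assms by (intro exI[of _ "\<lambda>_. G"]) auto

lemma generically_mono:
  "generically P \<Longrightarrow> (\<And>d. P d \<Longrightarrow> Q d) \<Longrightarrow> generically Q"
  unfolding generically_def by metis

lemma generically_all:
  assumes "\<And>n::nat. generically (P n)"
  shows "generically (\<lambda>d. \<forall>n. P n d)"
proof -
  obtain G where G: "\<And>n i u. \<exists>v. u @ v \<in> G n (i::nat)"
    "\<And>n d. (\<forall>i. \<exists>m. map d [0..<m] \<in> G n i) \<Longrightarrow> P n d"
    using assms unfolding generically_def by metis
  let ?G = "\<lambda>p. G (fst (prod_decode p)) (snd (prod_decode p))"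
  have "\<forall>n. P n d" if "\<forall>p. \<exists>m. map d [0..<m] \<in> ?G p" for d
  proof
    fix n
    have "\<exists>m. map d [0..<m] \<in> G n i" for i
      using that[rule_format, of "prod_encode (n, i)"] by simp
    then show "P n d" using G(2) by blast
  qed
  then show ?thesis
    unfolding generically_def using G(1) by (intro exI[of _ ?G]) auto
qed

lemma generically_conj:
  assumes "generically P" "generically Q"
  shows "generically (\<lambda>d. P d \<and> Q d)"
proof -
  have "generically (if n = 0 then P else Q)" for n :: nat
    using assms by simp
  then have "generically (\<lambda>d. \<forall>n::nat. (if n = 0 then P else Q) d)"
    by (rule generically_all)
  then show ?thesis
    by (rule generically_mono) (metis zero_neq_one)
qed

text \<open>
  The Baire category theorem: a comeager set meets every cylinder.  Starting with \<open>u\<close>, the dense sets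
  are met one after the other.
\<close>

lemma generic_extension:
  assumes "generically P"
  obtains d where "map d [0..<length u] = u" "P d"
proof -
  obtain G where G: "\<And>n u. \<exists>v. u @ v \<in> G (n::nat)"
    "\<And>d. (\<forall>n. \<exists>m. map d [0..<m] \<in> G n) \<Longrightarrow> P d"
    using assms unfolding generically_def by metis
  obtain v where v: "\<And>n u. u @ v n u \<in> G n"
    using that[of "\<lambda>n u. SOME v. u @ v \<in> G n"] someI_ex[OF G(1)] by blast
  \<comment> \<open>The additional arbitrary letter makes the lengths tend to infinity.\<close>
  define U where "U = rec_nat u (\<lambda>n w. w @ v n w @ [undefined])"
  have U0: "U 0 = u" and US: "U (Suc n) = U n @ v n (U n) @ [undefined]" for n
    by (simp_all add: U_def)
  have mono: "\<exists>w. U n = U m @ w" if "m \<le> n" for m n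
    using that by (induction rule: dec_induct) (auto simp: US)
  have len: "n \<le> length (U n)" for n
    by (induction n) (auto simp: US)
  define d where "d i = U (Suc i) ! i" for i
  have d: "d i = U n ! i" if "i < length (U n)" for i n
  proof (cases "n \<le> Suc i")
    case True
    then obtain w where "U (Suc i) = U n @ w" using mono by blast
    then show ?thesis using that by (simp add: d_def nth_append)
  next
    case False
    then obtain w where "U n = U (Suc i) @ w" using mono[of "Suc i" n] by auto
    then show ?thesis using len[of "Suc i"] by (simp add: d_def nth_append)
  qed
  have init: "map d [0..<m] = take m (U n)" if "m \<le> length (U n)" for m n
    using that d by (intro nth_equalityI) auto
  have "\<exists>m. map d [0..<m] \<in> G n" for n
    using v[of "U n" n] init[of "length (U n @ v n (U n))" "Suc n"]
    by (intro exI[of _ "length (U n @ v n (U n))"]) (simp add: US)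
  then have "P d" using G(2) by blast
  moreover have "map d [0..<length u] = u" using init[of "length u" 0] by (simp add: U0)
  ultimately show ?thesis using that by blast
qed

text \<open>
  Complements of open sets in a generic sense: a generic sequence avoids \<open>S\<close> with all its beginnings
  only if one of its beginnings already excludes \<open>S\<close>.  Compatibility with \<open>v\<close> in both directions is
  demanded since \<open>S\<close> need not be closed under extension.
\<close>

lemma generic_decision:
  fixes S :: "'a list set"
  shows "generically (\<lambda>d. (\<forall>m. map d [0..<m] \<notin> S) \<longleftrightarrow>
     (\<exists>m. \<forall>v. (\<exists>w. v = map d [0..<m] @ w \<or> map d [0..<m] = v @ w) \<longrightarrow> v \<notin> S))"
    (is "generically ?P")
proof -
  let ?comp = "\<lambda>u v. \<exists>w. v = u @ w \<or> u = v @ w"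
  let ?G = "{u. (\<exists>p w. u = p @ w \<and> p \<in> S) \<or> (\<forall>v. ?comp u v \<longrightarrow> v \<notin> S)}"
  have dense: "\<exists>v. u @ v \<in> ?G" for u
  proof (cases "\<forall>v. ?comp u v \<longrightarrow> v \<notin> S")
    case True
    then show ?thesis by (intro exI[of _ "[]"]) auto
  next
    case False
    then obtain v w where "v = u @ w \<or> u = v @ w" "v \<in> S" by blast
    then consider "u @ w \<in> S" | "u = v @ w" "v \<in> S" by blast
    then show ?thesis
    proof cases
      case 1
      then have "u @ w \<in> ?G" using append_Nil2[of "u @ w"] by blast
      then show ?thesis by blast
    next
      case 2
      then have "u @ [] \<in> ?G" by auto
      then show ?thesis by blast
    qed
  qed
  have comp: "?comp (map d [0..<m]) (map d [0..<n])" for d :: "nat \<Rightarrow> 'a" and m n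
    using initial_append[of m n d] initial_append[of n m d] nat_le_linear[of m n] by metis
  have decided: "?P d" if m: "map d [0..<m] \<in> ?G" for d m
  proof
    assume no: "\<forall>m. map d [0..<m] \<notin> S"
    have "p \<notin> S" if "map d [0..<m] = p @ w" for p w
    proof -
      have "m = length p + length w" using arg_cong[OF that, of length] by simp
      then have "p = take (length p) (map d [0..<m])" "length p \<le> m"
        using that by auto
      then have "p = map d [0..<length p]" by (simp add: take_map)
      then show ?thesis using no by metis
    qed
    then show "\<exists>m. \<forall>v. ?comp (map d [0..<m]) v \<longrightarrow> v \<notin> S" using m by blast
  next
    assume "\<exists>m. \<forall>v. ?comp (map d [0..<m]) v \<longrightarrow> v \<notin> S"
    then show "\<forall>m. map d [0..<m] \<notin> S" using comp by blast
  qed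
  show ?thesis
  proof (rule generically_mono[OF generically_meets_dense[of ?G, OF dense]])
    fix d assume "\<exists>m. map d [0..<m] \<in> ?G"
    then obtain m where "map d [0..<m] \<in> ?G" by (rule exE)
    then show "?P d" by (rule decided)
  qed
qed

section \<open>Descending one Borel class\<close>

text \<open>
  The Vaught transform along \<open>\<phi>\<close>.  A generic \<open>\<phi> y d\<close> lies in \<open>B\<close> if and only if some beginning of
  \<open>d\<close> forces it to, and for \<open>B\<close> in \<open>\<Sigma>\<^sup>0\<^sub>k\<^sub>+\<^sub>1\<close> the points \<open>y\<close> for which a given beginning does so form
  a \<open>\<Sigma>\<^sup>0\<^sub>k\<close> set.  The class drops by one because the second assumption turns the closed sets, which
  are the parts of a \<open>\<Sigma>\<^sup>0\<^sub>2\<close> set, into open sets; each further level of the hierarchy costs one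
  complementation and one countable union on both sides.
\<close>

lemma generic_membership_Sigma0:
  fixes \<phi> :: "'y::topological_space \<Rightarrow> (nat \<Rightarrow> 'c::countable) \<Rightarrow> omega_word"
  assumes cont: "\<And>y d n. \<exists>m. \<forall>e. map e [0..<m] = map d [0..<m] \<longrightarrow> (\<forall>j<n. \<phi> y e j = \<phi> y d j)"
    and opens: "\<And>F u. closed F \<Longrightarrow> open {y. \<forall>d. map d [0..<length u] = u \<longrightarrow> \<phi> y d \<in> F}"
    and "k \<ge> 1" and "Sigma0 (Suc k) B"
  shows "\<exists>S. (\<forall>u. Sigma0 k (S u)) \<and>
    (\<forall>y. generically (\<lambda>d. \<phi> y d \<in> B \<longleftrightarrow> (\<exists>m. y \<in> S (map d [0..<m]))))"
  using assms(3,4)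
proof (induction k arbitrary: B rule: nat_induct_at_least)
  case base
  obtain F where B: "B = (\<Union>n. F n)" and "\<And>n::nat. \<exists>j\<ge>1. j < Suc 1 \<and> Pi0 j (F n)"
    using Sigma0_UN_E[OF base] by auto
  then have F: "closed (F n)" for n
    by (metis Pi0_1_iff le_antisym less_Suc_eq_le)
  \<comment> \<open>A finite sequence forces membership in a closed set if all its extensions give elements of it.\<close>
  let ?S = "\<lambda>n u. {y. \<forall>d. map d [0..<length u] = u \<longrightarrow> \<phi> y d \<in> F n}"
  have "generically (\<lambda>d. \<phi> y d \<in> F n \<longleftrightarrow> (\<exists>m. y \<in> ?S n (map d [0..<m])))" for y n
  proof -
    \<comment> \<open>The undecided case is excluded densely because the complement of \<open>F n\<close> is open.\<close>
    let ?G = "{u. y \<in> ?S n u \<or> (\<forall>d. map d [0..<length u] = u \<longrightarrow> \<phi> y d \<notin> F n)}"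
    have "\<exists>v. u @ v \<in> ?G" for u
    proof (cases "y \<in> ?S n u")
      case True
      then show ?thesis by (intro exI[of _ "[]"]) auto
    next
      case False
      then obtain d where d: "map d [0..<length u] = u" "\<phi> y d \<in> - F n" by auto
      obtain l where l: "\<And>x. \<forall>i<l. x i = \<phi> y d i \<Longrightarrow> x \<in> - F n"
        using open_contains_cylinder[OF open_Compl[OF F] d(2)] by metis
      obtain m where m: "\<And>e. map e [0..<m] = map d [0..<m] \<Longrightarrow> \<forall>j<l. \<phi> y e j = \<phi> y d j"
        using cont by metis
      let ?v = "map d [0..<max m (length u)]"
      have "\<phi> y e \<notin> F n" if "map e [0..<length ?v] = ?v" for e
        using l m[of e] that by auto
      then have "?v \<in> ?G" by blast
      moreover have "?v = u @ map d [length u..<max m (length u)]"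
        using initial_append[of "length u" "max m (length u)" d] d(1) by simp
      ultimately have "u @ map d [length u..<max m (length u)] \<in> ?G" by (simp only:)
      then show ?thesis by blast
    qed
    from generically_meets_dense[of ?G, OF this] show ?thesis
      by (rule generically_mono) auto
  qed
  then have "generically (\<lambda>d. \<forall>n. \<phi> y d \<in> F n \<longleftrightarrow> (\<exists>m. y \<in> ?S n (map d [0..<m])))" for y
    by (intro generically_all)
  then have "generically (\<lambda>d. \<phi> y d \<in> B \<longleftrightarrow> (\<exists>m. y \<in> (\<Union>n. ?S n (map d [0..<m]))))" for y
  proof (rule generically_mono)
    fix d assume "\<forall>n. \<phi> y d \<in> F n \<longleftrightarrow> (\<exists>m. y \<in> ?S n (map d [0..<m]))"
    then have "(\<exists>n. \<phi> y d \<in> F n) \<longleftrightarrow> (\<exists>n m. y \<in> ?S n (map d [0..<m]))"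
      by (simp only:)
    also have "\<dots> \<longleftrightarrow> (\<exists>m. y \<in> (\<Union>n. ?S n (map d [0..<m])))"
      unfolding UN_iff by blast
    finally show "\<phi> y d \<in> B \<longleftrightarrow> (\<exists>m. y \<in> (\<Union>n. ?S n (map d [0..<m])))"
      unfolding B UN_iff by (simp only: UNIV_I bex_simps simp_thms)
  qed
  moreover have "Sigma0 1 (\<Union>n. ?S n u)" for u
    unfolding Sigma0_1_iff using opens[OF F] by (intro open_UN) auto
  ultimately show ?case by (intro exI[of _ "\<lambda>u. \<Union>n. ?S n u"]) auto
next
  case (Suc k)
  obtain F where B: "B = (\<Union>n. F n)" and F: "\<And>n::nat. \<exists>j\<ge>1. j < Suc (Suc k) \<and> Pi0 j (F n)"
    using Suc.prems Suc.hyps by (elim Sigma0_UN_E) auto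
  have "Sigma0 (Suc k) (- F n)" for n
    using F[of n] Suc.hyps Sigma0_mono[of _ "- F n" "Suc k"] by (auto simp: Sigma0_Compl)
  then have "\<forall>n. \<exists>S. (\<forall>u. Sigma0 k (S u)) \<and>
      (\<forall>y. generically (\<lambda>d. \<phi> y d \<in> - F n \<longleftrightarrow> (\<exists>m. y \<in> S (map d [0..<m]))))"
    by (intro allI Suc.IH)
  from choice[OF this] obtain S where S: "\<And>n u. Sigma0 k (S n u)"
    and gen: "\<And>n y. generically (\<lambda>d. \<phi> y d \<in> - F n \<longleftrightarrow> (\<exists>m. y \<in> S n (map d [0..<m])))"
    by blast
  \<comment> \<open>A finite sequence forces \<open>F n\<close> if nothing compatible with it forces the complement of \<open>F n\<close>.\<close>
  let ?T = "\<lambda>n u. (\<Inter>v. if \<exists>w. v = u @ w \<or> u = v @ w then - S n v else UNIV)"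
  have "generically (\<lambda>d. \<phi> y d \<in> B \<longleftrightarrow> (\<exists>m. y \<in> (\<Union>n. ?T n (map d [0..<m]))))" for y
  proof -
    let ?P = "\<lambda>n d. \<phi> y d \<in> - F n \<longleftrightarrow> (\<exists>m. y \<in> S n (map d [0..<m]))"
    let ?Q = "\<lambda>n d. (\<forall>m. map d [0..<m] \<notin> {u. y \<in> S n u}) \<longleftrightarrow>
     (\<exists>m. \<forall>v. (\<exists>w. v = map d [0..<m] @ w \<or> map d [0..<m] = v @ w) \<longrightarrow> v \<notin> {u. y \<in> S n u})"
    have "generically (\<lambda>d. (\<forall>n. ?P n d) \<and> (\<forall>n. ?Q n d))"
      by (intro generically_conj generically_all gen generic_decision)
    then show ?thesis
    proof (rule generically_mono)
      fix d assume *: "(\<forall>n. ?P n d) \<and> (\<forall>n. ?Q n d)"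
      have P: "?P n d" for n using * by (rule conjE) (erule spec)
      have Q: "?Q n d" for n using * by (rule conjE) (erule spec)
      have mem_if: "y \<in> (if c then - X else UNIV) \<longleftrightarrow> (c \<longrightarrow> y \<notin> X)" for c X
        by simp
      have T: "y \<in> ?T n u \<longleftrightarrow>
          (\<forall>v. (\<exists>w. v = u @ w \<or> u = v @ w) \<longrightarrow> v \<notin> {u. y \<in> S n u})" for n u
        unfolding INT_iff mem_if mem_Collect_eq by (simp only: ball_UNIV)
      have "\<phi> y d \<in> F n \<longleftrightarrow> (\<exists>m. y \<in> ?T n (map d [0..<m]))" for n
      proof -
        have "\<phi> y d \<in> F n \<longleftrightarrow> (\<forall>m. map d [0..<m] \<notin> {u. y \<in> S n u})"
          using P[of n] by blast
        also have "\<dots> \<longleftrightarrow> (\<exists>m. y \<in> ?T n (map d [0..<m]))"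
          unfolding Q T ..
        finally show ?thesis .
      qed
      then show "\<phi> y d \<in> B \<longleftrightarrow> (\<exists>m. y \<in> (\<Union>n. ?T n (map d [0..<m])))"
        unfolding B by blast
    qed
  qed
  moreover have "Sigma0 (Suc k) (\<Union>n. ?T n u)" for u
  proof (rule Sigma0_Suc_Union_Pi0[OF Suc.hyps])
    fix n
    have "Pi0 k (UNIV :: 'y set)"
    proof (cases "k = 1")
      case True then show ?thesis using Pi0_1_iff[of UNIV] by simp
    next
      case False
      then show ?thesis using Suc.hyps Pi0_INT[of k "\<lambda>_. UNIV"] Sigma0_1_iff[of UNIV] by force
    qed
    then show "Pi0 k (?T n u)"
      using S Suc.hyps by (intro Pi0_Inter) (auto simp: Pi0_Compl)
  qed
  ultimately show ?case by (intro exI[of _ "\<lambda>u. \<Union>n. ?T n u"]) auto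
qed

text \<open>
  When membership of \<open>\<phi> y d\<close> in \<open>B\<close> depends on \<open>y\<close> alone, generic membership is just membership of \<open>y\<close>
  in \<open>A\<close>.
\<close>

lemma Pi0_descent:
  fixes \<phi> :: "'y::topological_space \<Rightarrow> (nat \<Rightarrow> 'c::countable) \<Rightarrow> omega_word"
  assumes "\<And>y d n. \<exists>m. \<forall>e. map e [0..<m] = map d [0..<m] \<longrightarrow> (\<forall>j<n. \<phi> y e j = \<phi> y d j)"
    and "\<And>F u. closed F \<Longrightarrow> open {y. \<forall>d. map d [0..<length u] = u \<longrightarrow> \<phi> y d \<in> F}"
    and k: "k \<ge> 1" and B: "Pi0 (Suc k) B"
    and A: "\<And>y d. \<phi> y d \<in> B \<longleftrightarrow> y \<in> A"
  shows "Pi0 k A"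
proof -
  obtain S where S: "\<And>u. Sigma0 k (S u)"
    and gen: "\<And>y. generically (\<lambda>d. \<phi> y d \<in> - B \<longleftrightarrow> (\<exists>m. y \<in> S (map d [0..<m])))"
    using generic_membership_Sigma0[OF assms(1,2) k, of "- B"] B by (auto simp: Sigma0_Compl)
  have "- A = (\<Union>u. S u)"
  proof (intro equalityI subsetI)
    fix y assume "y \<in> - A"
    then show "y \<in> (\<Union>u. S u)"
      using generic_extension[OF gen[of y], of "[]"] A by (metis ComplD ComplI UN_I UNIV_I)
  next
    fix y assume "y \<in> (\<Union>u. S u)"
    then obtain u where "y \<in> S u" by blast
    then show "y \<in> - A"
      using generic_extension[OF gen[of y], of u] A by (metis ComplD ComplI)
  qed
  then have "Sigma0 k (- A)" using Sigma0_Union[OF k S] by simp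
  then show ?thesis by (simp add: Sigma0_Compl)
qed

section \<open>Infinite concatenations\<close>

definition omega_concat :: "(nat \<Rightarrow> word) \<Rightarrow> omega_word" where
  "omega_concat ws = snth (flat (smap ws nats))"

definition cut :: "(nat \<Rightarrow> word) \<Rightarrow> nat \<Rightarrow> nat" where
  "cut ws i = (\<Sum>j<i. length (ws j))"

lemma cut_0 [simp]: "cut ws 0 = 0"
  and cut_Suc: "cut ws (Suc i) = cut ws i + length (ws i)"
  by (simp_all add: cut_def)

lemma cut_mono: "i \<le> j \<Longrightarrow> cut ws i \<le> cut ws j"
  unfolding cut_def by (intro sum_mono2) auto

lemma cut_cong: "(\<And>j. j < i \<Longrightarrow> ws j = ws' j) \<Longrightarrow> cut ws i = cut ws' i"
  by (simp add: cut_def)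

lemma strict_mono_cut: "(\<And>i. ws i \<noteq> []) \<Longrightarrow> strict_mono (cut ws)"
  by (rule strict_mono_Suc_iff[THEN iffD2]) (simp add: cut_Suc)

text \<open>
  This determines \<open>flat us\<close> completely, since the segments cover all positions.
\<close>

lemma snth_flat_segment:
  assumes "\<And>i. us !! i \<noteq> []"
  shows "map (snth (flat us)) [cut (snth us) i..<cut (snth us) (Suc i)] = us !! i"
  using assms
proof (induction i arbitrary: us)
  case 0
  have ne: "shd us \<noteq> []" using 0[of 0] by simp
  then have "flat us = shd us @- flat (stl us)" by (subst flat_unfold) auto
  then show ?case by (intro nth_equalityI) (auto simp: cut_Suc)
next
  case (Suc i)
  have ne: "shd us \<noteq> []" using Suc.prems[of 0] by simp
  then have fl: "flat us = shd us @- flat (stl us)" by (subst flat_unfold) auto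
  have cut: "cut (snth us) (Suc j) = length (shd us) + cut (snth (stl us)) j" for j
    unfolding cut_def by (subst sum.lessThan_Suc_shift) simp
  have "map (snth (flat (stl us))) [cut (snth (stl us)) i..<cut (snth (stl us)) (Suc i)] = stl us !! i"
    using Suc.prems[of "Suc j" for j] by (intro Suc.IH) simp
  moreover have "map (snth (flat us)) [length (shd us) + a..<length (shd us) + b] =
      map (snth (flat (stl us))) [a..<b]" for a b
    unfolding fl by (intro nth_equalityI) auto
  ultimately show ?case by (simp only: cut snth.simps)
qed

lemma omega_concat_segment:
  assumes "\<And>i. ws i \<noteq> []"
  shows "map (omega_concat ws) [cut ws i..<cut ws (Suc i)] = ws i"
proof -
  have "snth (smap ws nats) = ws" by (auto simp: fun_eq_iff)
  then show ?thesis
    using snth_flat_segment[of "smap ws nats" i] assms by (simp add: omega_concat_def)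
qed

lemma strict_mono_nat_interval:
  fixes c :: "nat \<Rightarrow> nat"
  assumes "strict_mono c" "c 0 = 0"
  obtains i where "c i \<le> n" "n < c (Suc i)"
proof -
  have "\<exists>i. c i \<le> n \<and> n < c (Suc i)"
  proof (induction n)
    case 0
    then show ?case using assms strict_monoD[OF assms(1), of 0 1] by (intro exI[of _ 0]) simp
  next
    case (Suc n)
    then obtain i where i: "c i \<le> n" "n < c (Suc i)" by blast
    show ?case
    proof (cases "Suc n < c (Suc i)")
      case True then show ?thesis using i by (intro exI[of _ i]) simp
    next
      case False
      then show ?thesis using i strict_monoD[OF assms(1), of "Suc i" "Suc (Suc i)"]
        by (intro exI[of _ "Suc i"]) simp
    qed
  qed
  then show ?thesis using that by blast
qed

text \<open>
  Cut points are easier to handle than streams of words: both a word and the program that produces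
  it are cut, and the cuts are compared.
\<close>

lemma omega_power_iff_cuts:
  "x \<in> omega_power V \<longleftrightarrow>
    (\<exists>c. strict_mono c \<and> c 0 = 0 \<and> (\<forall>i. map x [c i..<c (Suc i)] \<in> V))"
proof
  assume "x \<in> omega_power V"
  then obtain us where us: "x = snth (flat us)" "us \<in> streams (V - {[]})"
    unfolding omega_power_def by blast
  then have "us !! i \<in> V" "us !! i \<noteq> []" for i
    using snth_in[OF us(2), of i] by auto
  then show "\<exists>c. strict_mono c \<and> c 0 = 0 \<and> (\<forall>i. map x [c i..<c (Suc i)] \<in> V)"
    using snth_flat_segment[of us] us(1) strict_mono_cut[of "snth us"]
    by (intro exI[of _ "cut (snth us)"]) auto
next
  assume "\<exists>c. strict_mono c \<and> c 0 = 0 \<and> (\<forall>i. map x [c i..<c (Suc i)] \<in> V)"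
  then obtain c where c: "strict_mono c" "c 0 = 0" "\<And>i. map x [c i..<c (Suc i)] \<in> V"
    by blast
  let ?ws = "\<lambda>i. map x [c i..<c (Suc i)]"
  have lt: "c i < c (Suc i)" for i using c(1) by (simp add: strict_mono_Suc_iff)
  have ne: "?ws i \<noteq> []" for i using lt[of i] by (simp add: not_le del: upt_Suc)
  have cut: "cut ?ws i = c i" for i
  proof (induction i)
    case (Suc i)
    then show ?case using lt[of i] by (simp add: cut_Suc)
  qed (simp add: c)
  have "x n = omega_concat ?ws n" for n
  proof -
    obtain i where i: "c i \<le> n" "n < c (Suc i)"
      using strict_mono_nat_interval[OF c(1,2)] by blast
    have "map (omega_concat ?ws) [c i..<c (Suc i)] = ?ws i"
      using omega_concat_segment[of ?ws i, OF ne] unfolding cut .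
    then show ?thesis using i by (simp add: map_eq_conv)
  qed
  then have "x = snth (flat (smap ?ws nats))"
    unfolding omega_concat_def by (simp add: fun_eq_iff)
  moreover have "smap ?ws nats \<in> streams (V - {[]})"
    using c(3) ne by (auto simp: streams_iff_snth simp del: map_eq_Cons_conv)
  ultimately show "x \<in> omega_power V"
    unfolding omega_power_def by blast
qed

section \<open>Words as stack programs\<close>

text \<open>
  The stack height after \<open>t\<close> instructions.  It is an integer and not truncated at 0, so that a factor
  of a program can be analysed by its height relative to the height where it begins.
\<close>

definition level :: "omega_word \<Rightarrow> nat \<Rightarrow> int" where
  "level x t = (\<Sum>i<t. if x (2 * i) then - 1 else 1)"

lemma level_0 [simp]: "level x 0 = 0"
  and level_Suc: "level x (Suc t) = level x t + (if x (2 * t) then - 1 else 1)"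
  by (simp_all add: level_def)

lemma level_shift:
  assumes "\<And>i. i < 2 * n \<Longrightarrow> x' (2 * s' + i) = x (2 * s + i)" "m \<le> n"
  shows "level x' (s' + m) - level x' s' = level x (s + m) - level x s"
  using assms(2)
proof (induction m)
  case (Suc m)
  then show ?case using assms(1)[of "2 * m"] by (simp add: level_Suc algebra_simps)
qed simp

lemma level_cong: "(\<And>i. i < 2 * t \<Longrightarrow> x' i = x i) \<Longrightarrow> level x' t = level x t"
  using level_shift[of t x' 0 x 0 t] by simp

text \<open>
  The instructions from \<open>s\<close> up to \<open>t\<close> leave the part of the stack present at time \<open>s\<close> untouched and
  put \<open>y\<close> on top of it.  The letter \<open>y ! i\<close> is found at the last time \<open>r\<close> when the height exceeds the
  initial one by \<open>i\<close>; as the height is greater at time \<open>r + 1\<close>, the instruction at \<open>r\<close> is a push, and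
  its second bit is the letter pushed.
\<close>

definition reduces_on :: "omega_word \<Rightarrow> nat \<Rightarrow> nat \<Rightarrow> word \<Rightarrow> bool" where
  "reduces_on x s t y \<longleftrightarrow> s \<le> t \<and> (\<forall>r\<in>{s..t}. level x s \<le> level x r) \<and>
     level x t = level x s + int (length y) \<and>
     (\<forall>i<length y. \<exists>r\<in>{s..<t}. level x r = level x s + int i \<and> x (2 * r + 1) = y ! i \<and>
        (\<forall>q\<in>{r<..t}. level x s + int i < level x q))"

text \<open>
  Reduction is invariant under translation and insensitive to bits outside of the factor.  All
  transfers between finite words and factors of infinite words are instances.
\<close>

lemma reduces_on_shift:
  assumes "reduces_on x s (s + n) y"
    and eq: "\<And>i. i < 2 * n \<Longrightarrow> x' (2 * s' + i) = x (2 * s + i)"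
  shows "reduces_on x' s' (s' + n) y"
proof -
  have lev: "level x' (s' + m) = level x (s + m) - level x s + level x' s'" if "m \<le> n" for m
    using level_shift[of n x' s' x s m, OF eq that] by simp
  note red = assms(1)[unfolded reduces_on_def]
  have "level x' s' \<le> level x' r" if r: "r \<in> {s'..s' + n}" for r
  proof -
    obtain m where m: "r = s' + m" "m \<le> n" using r by (auto simp: le_iff_add)
    have "level x s \<le> level x (s + m)" using red m(2) by auto
    then show ?thesis using lev[OF m(2)] m(1) by simp
  qed
  moreover have "level x' (s' + n) = level x' s' + int (length y)"
    using lev[of n] red by simp
  moreover have "\<exists>r\<in>{s'..<s' + n}. level x' r = level x' s' + int i \<and> x' (2 * r + 1) = y ! i \<and>
        (\<forall>q\<in>{r<..s' + n}. level x' s' + int i < level x' q)" if i: "i < length y" for i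
  proof -
    obtain r where r: "r \<in> {s..<s + n}" "level x r = level x s + int i" "x (2 * r + 1) = y ! i"
      "\<forall>q\<in>{r<..s + n}. level x s + int i < level x q"
      using red i by blast
    obtain m where m: "r = s + m" "m < n" using r(1) by (auto simp: le_iff_add)
    have "level x' (s' + m) = level x' s' + int i" using lev[of m] m r(2) by simp
    moreover have "x' (2 * (s' + m) + 1) = y ! i"
      using eq[of "2 * m + 1"] m r(3) by (simp add: algebra_simps)
    moreover have "level x' s' + int i < level x' q" if q: "q \<in> {s' + m<..s' + n}" for q
    proof -
      obtain p where p: "q = s' + p" "m < p" "p \<le> n" using q by (auto simp: less_iff_Suc_add)
      then have "level x s + int i < level x (s + p)" using r(4) m(1) by simp
      then show ?thesis using lev[of p] p by simp
    qed
    ultimately show ?thesis using m(2) by (intro bexI[of _ "s' + m"]) auto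
  qed
  ultimately show ?thesis unfolding reduces_on_def by simp
qed

lemma reduces_on_append:
  assumes v: "reduces_on x r s v" and w: "reduces_on x s t w"
  shows "reduces_on x r t (v @ w)"
proof -
  note v' = v[unfolded reduces_on_def] and w' = w[unfolded reduces_on_def]
  have "level x r \<le> level x q" if "q \<in> {r..t}" for q
  proof (cases "q \<le> s")
    case False
    then have "level x s \<le> level x q" using w' that by simp
    then show ?thesis using v' by simp
  qed (use v' that in simp)
  moreover have "\<exists>p\<in>{r..<t}. level x p = level x r + int i \<and> x (2 * p + 1) = (v @ w) ! i \<and>
        (\<forall>q\<in>{p<..t}. level x r + int i < level x q)" if i: "i < length (v @ w)" for i
  proof (cases "i < length v")
    case True
    then obtain p where p: "p \<in> {r..<s}" "level x p = level x r + int i" "x (2 * p + 1) = v ! i"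
      "\<forall>q\<in>{p<..s}. level x r + int i < level x q"
      using v' by blast
    have "level x r + int i < level x q" if "q \<in> {p<..t}" for q
    proof (cases "q \<le> s")
      case False
      then have "level x s \<le> level x q" using w' that by auto
      then show ?thesis using v' True by simp
    qed (use p that in auto)
    then show ?thesis using p True w' by (intro bexI[of _ p]) (auto simp: nth_append)
  next
    case False
    then have "i - length v < length w" using i by simp
    then obtain p where p: "p \<in> {s..<t}" "level x p = level x s + int (i - length v)"
      "x (2 * p + 1) = w ! (i - length v)"
      "\<forall>q\<in>{p<..t}. level x s + int (i - length v) < level x q"
      using w' by blast
    then show ?thesis using False v' by (intro bexI[of _ p]) (auto simp: nth_append)
  qed
  ultimately show ?thesis using v' w' unfolding reduces_on_def by auto
qed

text \<open>
  The word is turned into an infinite one by \<open>(!)\<close>, whose arbitrary values beyond the length of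
  \<open>w\<close> do not enter.
\<close>

definition reduces :: "word \<Rightarrow> word \<Rightarrow> bool" where
  "reduces w y \<longleftrightarrow> even (length w) \<and> reduces_on ((!) w) 0 (length w div 2) y"

lemma reduces_factor:
  assumes "s \<le> t"
  shows "reduces (map x [2 * s..<2 * t]) y \<longleftrightarrow> reduces_on x s t y"
proof -
  obtain n where t: "t = s + n" using assms by (auto simp: le_iff_add)
  let ?w = "map x [2 * s..<2 * t]"
  have len: "length ?w = 2 * n" by (simp add: t)
  have eq: "(!) ?w (2 * 0 + i) = x (2 * s + i)" if "i < 2 * n" for i
    using that by (simp add: t)
  show ?thesis
    unfolding reduces_def len t
    using reduces_on_shift[of x s n y "(!) ?w" 0] reduces_on_shift[of "(!) ?w" 0 n y x s] eq
    by (auto simp: t)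
qed

lemma reduces_Nil: "reduces [] []"
  by (simp add: reduces_def reduces_on_def)

lemma reduces_append:
  assumes v: "reduces v y" and w: "reduces w z"
  shows "reduces (v @ w) (y @ z)"
proof -
  obtain m n where mn: "length v = 2 * m" "length w = 2 * n"
    using v w by (auto simp: reduces_def elim!: evenE)
  have "reduces_on ((!) (v @ w)) 0 m y"
    using reduces_on_shift[of "(!) v" 0 m y "(!) (v @ w)" 0] v mn
    by (simp add: reduces_def nth_append)
  moreover have "reduces_on ((!) (v @ w)) m (m + n) z"
    using reduces_on_shift[of "(!) w" 0 n z "(!) (v @ w)" m] w mn
    by (simp add: reduces_def nth_append)
  ultimately show ?thesis
    using reduces_on_append mn by (simp add: reduces_def)
qed

lemma reduces_push: "reduces [False, b] [b]"
  unfolding reduces_def reduces_on_def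
  by (auto simp: level_Suc atLeastAtMost_singleton_iff le_Suc_eq intro!: bexI[of _ 0])

lemma reduces_pop:
  assumes "reduces w (y @ [b])"
  shows "reduces (w @ [True, c]) y"
proof -
  obtain n where n: "length w = 2 * n" using assms by (auto simp: reduces_def elim!: evenE)
  let ?x = "(!) (w @ [True, c])"
  have "reduces_on ?x 0 n (y @ [b])"
    using reduces_on_shift[of "(!) w" 0 n "y @ [b]" ?x 0] assms n
    by (simp add: reduces_def nth_append)
  note red0 = this[unfolded reduces_on_def]
  note red = red0[simplified]
  have lev: "level ?x (Suc n) = int (length y)"
    using red n by (simp add: level_Suc nth_append)
  have "\<exists>r\<in>{0..<Suc n}. level ?x r = int i \<and> ?x (2 * r + 1) = y ! i \<and>
        (\<forall>q\<in>{r<..Suc n}. int i < level ?x q)" if i: "i < length y" for i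
  proof -
    have "i < length (y @ [b])" using i by simp
    then obtain r where "r \<in> {0..<n}" "level ?x r = level ?x 0 + int i"
        "?x (2 * r + 1) = (y @ [b]) ! i" "\<forall>q\<in>{r<..n}. level ?x 0 + int i < level ?x q"
      using red0 by blast
    then show ?thesis
      using i lev by (intro bexI[of _ r]) (auto simp: le_Suc_eq nth_append)
  qed
  moreover have "0 \<le> level ?x r" if "r \<le> Suc n" for r
    using that red lev by (auto simp: le_Suc_eq)
  ultimately have "reduces_on ?x 0 (Suc n) y"
    using lev unfolding reduces_on_def by auto
  then show ?thesis using n by (simp add: reduces_def)
qed

text \<open>
  The property that makes gaps flexible: whatever a program has written, it can be continued to one
  that leaves no trace.
\<close>

lemma reduces_erase:
  assumes "reduces w y"
  obtains e where "reduces (w @ e) []"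
proof -
  have "\<exists>e. reduces (w @ e) []" using assms
  proof (induction y arbitrary: w rule: rev_induct)
    case Nil
    then show ?case by (intro exI[of _ "[]"]) simp
  next
    case (snoc b y)
    then show ?case using reduces_pop[of w y b True] by (metis append_assoc)
  qed
  then show ?thesis using that by blast
qed

section \<open>The limit of an infinite stack program\<close>

text \<open>
  The letter \<open>y j\<close> is pushed at the last time when the height is \<open>j\<close>.  The existence of such times
  for all \<open>j\<close> makes the height tend to infinity.
\<close>

definition settles :: "omega_word \<Rightarrow> omega_word \<Rightarrow> bool" where
  "settles x y \<longleftrightarrow> (\<forall>t. 0 \<le> level x t) \<and>
     (\<forall>j. \<exists>t. level x t = int j \<and> x (2 * t + 1) = y j \<and> (\<forall>r>t. int j < level x r))"

lemma settles_times:
  assumes "settles x y"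
  obtains p where "\<And>j. level x (p j) = int j" "\<And>j. x (2 * p j + 1) = y j"
    "\<And>j r. p j < r \<Longrightarrow> int j < level x r"
proof -
  have "\<forall>j. \<exists>t. level x t = int j \<and> x (2 * t + 1) = y j \<and> (\<forall>r>t. int j < level x r)"
    using assms by (simp add: settles_def)
  from choice[OF this] show ?thesis using that by blast
qed

text \<open>
  After the \<open>i\<close>-th cut the height never falls below \<open>c i\<close>, so a letter that survives its own segment
  is never popped later.
\<close>

lemma settles_of_segments:
  assumes a: "a 0 = 0" and c: "strict_mono c" "c 0 = 0"
    and red: "\<And>i. reduces_on x (a i) (a (Suc i)) (map y [c i..<c (Suc i)])"
  shows "settles x y"
proof -
  have c_less: "c i < c (Suc i)" for i using c(1) by (simp add: strict_mono_Suc_iff)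
  have seg: "a i \<le> a (Suc i)" "\<And>r. a i \<le> r \<Longrightarrow> r \<le> a (Suc i) \<Longrightarrow> level x (a i) \<le> level x r"
    "level x (a (Suc i)) = level x (a i) + (int (c (Suc i)) - int (c i))" for i
    using red[of i] c_less[of i] by (auto simp: reduces_on_def of_nat_diff simp del: upt_Suc)
  have lev: "level x (a i) = int (c i)" for i
    by (induction i) (simp_all add: a c seg(3))
  have "a i < a (Suc i)" for i
    using seg(1)[of i] lev[of i] lev[of "Suc i"] c_less[of i] by (metis le_neq_implies_less less_irrefl of_nat_eq_iff)
  then have mono: "strict_mono a" by (simp add: strict_mono_Suc_iff)
  have after: "int (c i) \<le> level x r" if r: "a i \<le> r" for i r
  proof -
    obtain k where k: "a k \<le> r" "r < a (Suc k)"
      using strict_mono_nat_interval[OF mono a] by blast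
    have "a i < a (Suc k)" using r k(2) by simp
    then have "i \<le> k" using strict_mono_less[OF mono] by simp
    then have "c i \<le> c k" using strict_mono_less_eq[OF c(1)] by simp
    then show ?thesis using seg(2)[of k r] k lev[of k] by simp
  qed
  have "\<exists>t. level x t = int j \<and> x (2 * t + 1) = y j \<and> (\<forall>r>t. int j < level x r)" for j
  proof -
    obtain i where i: "c i \<le> j" "j < c (Suc i)"
      using strict_mono_nat_interval[OF c] by blast
    then have "j - c i < length (map y [c i..<c (Suc i)])" by (simp del: upt_Suc)
    then obtain t where t: "t \<in> {a i..<a (Suc i)}" "level x t = level x (a i) + int (j - c i)"
      "x (2 * t + 1) = map y [c i..<c (Suc i)] ! (j - c i)"
      "\<forall>q\<in>{t<..a (Suc i)}. level x (a i) + int (j - c i) < level x q"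
      using red[of i] unfolding reduces_on_def by blast
    have "int j < level x r" if "r > t" for r
    proof (cases "r \<le> a (Suc i)")
      case True
      then show ?thesis using t(4) that lev[of i] i(1) by (auto simp: of_nat_diff)
    next
      case False
      then show ?thesis using after[of "Suc i" r] i(2) by simp
    qed
    moreover have "level x t = int j" using t(2) lev[of i] i(1) by (simp add: of_nat_diff)
    moreover have "x (2 * t + 1) = y j" using t(3) i by (simp del: upt_Suc)
    ultimately show ?thesis by blast
  qed
  then show ?thesis using after[of 0] a c(2) unfolding settles_def by simp
qed

lemma settles_unique:
  assumes "settles x y" "settles x z"
  shows "y = z"
proof
  fix j
  obtain t where t: "level x t = int j" "x (2 * t + 1) = y j" "\<forall>r>t. int j < level x r"
    using assms(1) unfolding settles_def by blast
  obtain s where s: "level x s = int j" "x (2 * s + 1) = z j" "\<forall>r>s. int j < level x r"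
    using assms(2) unfolding settles_def by blast
  have "s = t"
    using t(1,3) s(1,3) by (metis less_irrefl linorder_neqE_nat)
  then show "y j = z j" using t(2) s(2) by simp
qed

text \<open>
  The empty \<open>y\<close> is excluded: an infinite concatenation of programs that leave no trace does not settle.
\<close>

definition stack_dictionary :: "dictionary \<Rightarrow> dictionary" where
  "stack_dictionary A w \<longleftrightarrow> (\<exists>y. y \<noteq> [] \<and> A y \<and> reduces w y)"

text \<open>
  Conversely to \<open>settles_of_segments\<close>, a settling program is cut at the times when the letters number
  \<open>c i\<close> are pushed for good; the first cut has to be moved to 0.
\<close>

lemma settles_segments:
  assumes x: "settles x y" and c: "strict_mono c" "c 0 = 0"
  obtains a where "strict_mono a" "a 0 = 0"
    "\<And>i. reduces_on x (a i) (a (Suc i)) (map y [c i..<c (Suc i)])"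
proof -
  obtain p where p: "\<And>j. level x (p j) = int j" "\<And>j. x (2 * p j + 1) = y j"
    "\<And>j r. p j < r \<Longrightarrow> int j < level x r"
    using settles_times[OF x] by blast
  have p_less: "p i < p j \<longleftrightarrow> i < j" for i j
    using p(3)[of i "p j"] p(3)[of j "p i"] p(1) by (metis less_irrefl linorder_neqE_nat not_less_iff_gr_or_eq of_nat_less_iff)
  then have p_le: "p i \<le> p j \<longleftrightarrow> i \<le> j" for i j
    by (metis not_less)
  have c_less: "c i < c (Suc i)" for i using c(1) by (simp add: strict_mono_Suc_iff)
  define a where "a i = (if i = 0 then 0 else p (c i))" for i
  have a_less: "a i < a (Suc i)" for i
    using p_less[of "c i" "c (Suc i)"] c_less[of i] p_less[of 0 "c 1"] c(2)
    by (auto simp: a_def)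
  have lev: "level x (a i) = int (c i)" for i by (simp add: a_def p c)
  have after: "int (c i) \<le> level x r" if "a i \<le> r" for i r
  proof (cases "i = 0")
    case True then show ?thesis using x c by (simp add: settles_def)
  next
    case False
    then show ?thesis using that p(3)[of "c i" r] p(1)[of "c i"] by (cases "p (c i) = r") (auto simp: a_def)
  qed
  have "reduces_on x (a i) (a (Suc i)) (map y [c i..<c (Suc i)])" for i
  proof -
    have "\<exists>r\<in>{a i..<a (Suc i)}. level x r = int (c i) + int l \<and>
        x (2 * r + 1) = map y [c i..<c (Suc i)] ! l \<and>
        (\<forall>q\<in>{r<..a (Suc i)}. int (c i) + int l < level x q)" if l: "l < c (Suc i) - c i" for l
    proof (rule bexI[of _ "p (c i + l)"])
      show "p (c i + l) \<in> {a i..<a (Suc i)}"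
        using l p_less p_le by (auto simp: a_def)
      show "level x (p (c i + l)) = int (c i) + int l \<and>
        x (2 * p (c i + l) + 1) = map y [c i..<c (Suc i)] ! l \<and>
        (\<forall>q\<in>{p (c i + l)<..a (Suc i)}. int (c i) + int l < level x q)"
        using l p(1,2) p(3)[of "c i + l"] by (auto simp del: upt_Suc)
    qed
    then show ?thesis
      using a_less[of i] after[of i] c_less[of i]
      by (auto simp: reduces_on_def lev of_nat_diff simp del: upt_Suc)
  qed
  then show ?thesis using that[of a] a_less by (simp add: strict_mono_Suc_iff a_def)
qed

lemma omega_power_stack_dictionary:
  "x \<in> omega_power {w. stack_dictionary A w} \<longleftrightarrow> (\<exists>y\<in>omega_power {w. A w}. settles x y)"
proof
  assume "x \<in> omega_power {w. stack_dictionary A w}"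
  then obtain b where b: "strict_mono b" "b 0 = 0"
    "\<And>i. stack_dictionary A (map x [b i..<b (Suc i)])"
    unfolding omega_power_iff_cuts by auto
  then obtain ys where ys: "\<And>i. ys i \<noteq> []" "\<And>i. A (ys i)"
    "\<And>i. reduces (map x [b i..<b (Suc i)]) (ys i)"
    unfolding stack_dictionary_def by metis
  have even: "even (b i)" for i
  proof (induction i)
    case (Suc i)
    have "b i < b (Suc i)" using b(1) by (simp add: strict_mono_Suc_iff)
    then show ?case using ys(3)[of i] Suc by (simp add: reduces_def del: upt_Suc)
  qed (simp add: b)
  define a where "a i = b i div 2" for i
  have ba: "b i = 2 * a i" for i using even by (simp add: a_def)
  define y where "y = omega_concat ys"
  have y: "map y [cut ys i..<cut ys (Suc i)] = ys i" for i
    unfolding y_def using ys(1) by (rule omega_concat_segment)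
  have "y \<in> omega_power {w. A w}"
    unfolding omega_power_iff_cuts using strict_mono_cut[of ys, OF ys(1)] y ys(2)
    by (intro exI[of _ "cut ys"]) (simp del: upt_Suc)
  moreover have "settles x y"
  proof (rule settles_of_segments)
    show "a 0 = 0" by (simp add: a_def b)
    show "strict_mono (cut ys)" by (rule strict_mono_cut[OF ys(1)])
    show "reduces_on x (a i) (a (Suc i)) (map y [cut ys i..<cut ys (Suc i)])" for i
    proof -
      have "a i \<le> a (Suc i)" using b(1) ba by (metis le_SucI div_le_mono a_def order_refl strict_mono_less_eq)
      then show ?thesis using ys(3)[of i] by (simp only: y ba reduces_factor)
    qed
  qed simp
  ultimately show "\<exists>y\<in>omega_power {w. A w}. settles x y" by blast
next
  assume "\<exists>y\<in>omega_power {w. A w}. settles x y"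
  then obtain y where y: "settles x y" "y \<in> omega_power {w. A w}"
    by blast
  then obtain c where c: "strict_mono c" "c 0 = 0" "\<And>i. map y [c i..<c (Suc i)] \<in> {w. A w}"
    unfolding omega_power_iff_cuts by blast
  obtain a where a: "strict_mono a" "a 0 = 0"
    "\<And>i. reduces_on x (a i) (a (Suc i)) (map y [c i..<c (Suc i)])"
    using settles_segments[OF y(1) c(1,2)] by metis
  have "stack_dictionary A (map x [2 * a i..<2 * a (Suc i)])" for i
  proof -
    have "a i \<le> a (Suc i)" using a(1) by (simp add: strict_mono_less_eq)
    then have "reduces (map x [2 * a i..<2 * a (Suc i)]) (map y [c i..<c (Suc i)])"
      using a(3) by (simp only: reduces_factor)
    moreover have "map y [c i..<c (Suc i)] \<noteq> []"
      using strict_monoD[OF c(1), of i "Suc i"] by (simp add: not_le del: upt_Suc)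
    ultimately show ?thesis using c(3)[of i] unfolding stack_dictionary_def mem_Collect_eq by blast
  qed
  then show "x \<in> omega_power {w. stack_dictionary A w}"
    unfolding omega_power_iff_cuts using a
    by (intro exI[of _ "\<lambda>i. 2 * a i"]) (simp add: strict_mono_def del: upt_Suc)
qed

lemma continuous_stack_dictionary: "continuous_on UNIV stack_dictionary"
proof (rule continuous_on_coordinatewise_then_product)
  fix w
  let ?Y = "{y. y \<noteq> [] \<and> reduces w y}"
  have "?Y \<subseteq> {y. set y \<subseteq> UNIV \<and> length y = nat (level ((!) w) (length w div 2))}"
    by (auto simp: reduces_def reduces_on_def)
  then have fin: "finite ?Y"
    by (rule finite_subset) (rule finite_lists_length_eq, simp)
  have op: "open ((\<lambda>A::dictionary. A y) -` {b})" for y b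
    by (intro open_vimage open_discrete continuous_on_product_coordinates)
  have T: "{A. stack_dictionary A w} = (\<Union>y\<in>?Y. (\<lambda>A::dictionary. A y) -` {True})"
    by (auto simp: stack_dictionary_def)
  have F: "{A. \<not> stack_dictionary A w} = (\<Inter>y\<in>?Y. (\<lambda>A::dictionary. A y) -` {False})"
    by (auto simp: stack_dictionary_def)
  have openT: "open {A. stack_dictionary A w}" unfolding T using op by (intro open_UN) auto
  have openF: "open {A. \<not> stack_dictionary A w}" unfolding F using op fin by (intro open_INT) auto
  show "continuous_on UNIV (\<lambda>A. stack_dictionary A w)"
    unfolding continuous_on_open_vimage[OF open_UNIV]
  proof (intro allI impI)
    fix B :: "bool set"
    have "(\<lambda>A. stack_dictionary A w) -` B \<inter> UNIV =
        (if True \<in> B then {A. stack_dictionary A w} else {}) \<union>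
        (if False \<in> B then {A. \<not> stack_dictionary A w} else {})"
    proof (rule set_eqI)
      fix A
      show "A \<in> (\<lambda>A. stack_dictionary A w) -` B \<inter> UNIV \<longleftrightarrow>
        A \<in> (if True \<in> B then {A. stack_dictionary A w} else {}) \<union>
          (if False \<in> B then {A. \<not> stack_dictionary A w} else {})"
        by (cases "stack_dictionary A w") simp_all
    qed
    then show "open ((\<lambda>A. stack_dictionary A w) -` B \<inter> UNIV)"
      using openT openF by (simp add: open_Un)
  qed
qed

section \<open>The limit raises the Borel class by one\<close>

lemma closed_level_condition:
  "closed {x. \<forall>r. P r (level x r)}"
proof -
  have "closed {x. P r (level x r)}" for r
    by (rule closed_finitely_determined[where n = "2 * r"]) (metis level_cong mem_Collect_eq)
  then show ?thesis unfolding Collect_all_eq by (intro closed_INT) auto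
qed

text \<open>
  Let \<open>ts\<close> be the list of the times at which the first letters are pushed for good.  That these
  letters ensure membership in \<open>U\<close> is a clopen condition once \<open>ts\<close> is given, and that \<open>ts\<close> is as
  described is a closed one.  There are countably many \<open>ts\<close>.
\<close>

lemma limit_preimage_open:
  assumes "open U"
  shows "\<exists>C. Sigma0 2 C \<and> (\<forall>x y. settles x y \<longrightarrow> (x \<in> C \<longleftrightarrow> y \<in> U))"
proof -
  let ?D = "\<lambda>ts. {x. \<forall>j<length ts. level x (ts ! j) = int j \<and> (\<forall>r>ts ! j. int j < level x r)}"
  let ?E = "\<lambda>ts. {x::omega_word. \<forall>y. (\<forall>j<length ts. y j = x (2 * (ts ! j) + 1)) \<longrightarrow> y \<in> U}"
  have "closed (?D ts \<inter> ?E ts)" for ts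
  proof (rule closed_Int)
    have "?D ts = {x. \<forall>r. \<forall>j<length ts. (r = ts ! j \<longrightarrow> level x r = int j) \<and> (r > ts ! j \<longrightarrow> int j < level x r)}"
      by auto
    then show "closed (?D ts)"
      using closed_level_condition[of "\<lambda>r l. \<forall>j<length ts. (r = ts ! j \<longrightarrow> l = int j) \<and> (r > ts ! j \<longrightarrow> int j < l)"]
      by simp
    obtain n where n: "\<forall>t\<in>set ts. t < n" using finite_nat_bounded[of "set ts"] by blast
    show "closed (?E ts)"
    proof (rule closed_finitely_determined[where n = "2 * n"])
      fix x x' :: omega_word assume x: "x \<in> ?E ts" and eq: "\<forall>i<2 * n. x' i = x i"
      have "x' (2 * (ts ! j) + 1) = x (2 * (ts ! j) + 1)" if "j < length ts" for j
      proof -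
        have "ts ! j < n" using n that by simp
        then have "2 * (ts ! j) + 1 < 2 * n" by simp
        then show ?thesis using eq by blast
      qed
      then show "x' \<in> ?E ts" using x by simp
    qed
  qed
  then have "Sigma0 (Suc 1) (\<Union>ts. ?D ts \<inter> ?E ts)"
    by (intro Sigma0_Suc_Union_Pi0) (simp_all only: Pi0_1_iff order_refl)
  moreover have "x \<in> (\<Union>ts. ?D ts \<inter> ?E ts) \<longleftrightarrow> y \<in> U" if "settles x y" for x y
  proof -
    obtain p where p: "\<And>j. level x (p j) = int j" "\<And>j. x (2 * p j + 1) = y j"
      "\<And>j r. p j < r \<Longrightarrow> int j < level x r"
      using settles_times[OF \<open>settles x y\<close>] by blast
    show ?thesis
    proof
      assume "x \<in> (\<Union>ts. ?D ts \<inter> ?E ts)"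
      then obtain ts where ts: "x \<in> ?D ts" "x \<in> ?E ts" by blast
      have "ts ! j = p j" if "j < length ts" for j
        using ts(1) that p(1)[of j] p(3)[of j "ts ! j"] 
        by (metis (mono_tags, lifting) less_irrefl linorder_neqE_nat mem_Collect_eq)
      then show "y \<in> U" using ts(2) p(2) by simp
    next
      assume "y \<in> U"
      then obtain n where n: "\<And>z. \<forall>i<n. z i = y i \<Longrightarrow> z \<in> U"
        using open_contains_cylinder[OF assms] by metis
      have "x \<in> ?D (map p [0..<n]) \<inter> ?E (map p [0..<n])"
        using p n by simp
      then show "x \<in> (\<Union>ts. ?D ts \<inter> ?E ts)" by (rule UN_I[OF UNIV_I])
    qed
  qed
  ultimately show ?thesis unfolding numeral_2_eq_2 One_nat_def by blast
qed

lemma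
  shows limit_preimage_Sigma0: "Sigma0 k B \<Longrightarrow>
      \<exists>C. Sigma0 (Suc k) C \<and> (\<forall>x y. settles x y \<longrightarrow> (x \<in> C \<longleftrightarrow> y \<in> B))"
    and limit_preimage_Pi0: "Pi0 l D \<Longrightarrow>
      \<exists>C. Pi0 (Suc l) C \<and> (\<forall>x y. settles x y \<longrightarrow> (x \<in> C \<longleftrightarrow> y \<in> D))"
proof (induction rule: Sigma0_Pi0.inducts)
  case (Sigma0_open U)
  then show ?case using limit_preimage_open by (simp add: numeral_2_eq_2)
next
  case (Pi0_closed C)
  obtain E where E: "Sigma0 2 E" "\<And>x y. settles x y \<Longrightarrow> x \<in> E \<longleftrightarrow> y \<in> - C"
    using limit_preimage_open[of "- C"] Pi0_closed by (metis open_Compl)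
  then show ?case
    by (intro exI[of _ "- E"]) (simp add: Pi0_Compl numeral_2_eq_2)
next
  case (Sigma0_UN k F)
  obtain C where C: "\<And>n. \<exists>j\<ge>1. j < k \<and> Pi0 (Suc j) (C n)"
    "\<And>n x y. settles x y \<Longrightarrow> x \<in> C n \<longleftrightarrow> y \<in> F n"
    using Sigma0_UN.IH by metis
  have "\<exists>j\<ge>1. j < Suc k \<and> Pi0 j (C n)" for n
    using C(1)[of n] by (metis Suc_less_eq le_SucI)
  then have "Sigma0 (Suc k) (\<Union>n. C n)"
    using Sigma0_UN.hyps by (intro Sigma0_Pi0.Sigma0_UN) auto
  then show ?case using C(2) by (intro exI[of _ "\<Union>n. C n"]) auto
next
  case (Pi0_INT k F)
  obtain C where C: "\<And>n. \<exists>j\<ge>1. j < k \<and> Sigma0 (Suc j) (C n)"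
    "\<And>n x y. settles x y \<Longrightarrow> x \<in> C n \<longleftrightarrow> y \<in> F n"
    using Pi0_INT.IH by metis
  have "\<exists>j\<ge>1. j < Suc k \<and> Sigma0 j (C n)" for n
    using C(1)[of n] by (metis Suc_less_eq le_SucI)
  then have "Pi0 (Suc k) (\<Inter>n. C n)"
    using Pi0_INT.hyps by (intro Sigma0_Pi0.Pi0_INT) auto
  then show ?case using C(2) by (intro exI[of _ "\<Inter>n. C n"]) auto
qed

text \<open>
  For all \<open>j\<close> there is a last time \<open>t\<close> with height \<open>j\<close>, where the property of \<open>j\<close> and \<open>t\<close> is closed.
\<close>

lemma Pi0_3_settles: "Pi0 3 {x. \<exists>y. settles x y}"
proof -
  let ?C = "\<lambda>j t. {x. \<forall>r. 0 \<le> level x r \<and> (r = t \<longrightarrow> level x r = int j) \<and> (r > t \<longrightarrow> int j < level x r)}"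
  have "Pi0 1 (?C j t)" for j t
    unfolding Pi0_1_iff
    by (rule closed_level_condition[of "\<lambda>r l. 0 \<le> l \<and> (r = t \<longrightarrow> l = int j) \<and> (r > t \<longrightarrow> int j < l)"])
  then have "Sigma0 (Suc 1) (\<Union>t. ?C j t)" for j
    by (intro Sigma0_Suc_Union_Pi0) simp_all
  then have "Pi0 (Suc (Suc 1)) (\<Inter>j. \<Union>t. ?C j t)"
    by (intro Pi0_Suc_Inter_Sigma0) simp_all
  moreover have "(\<Inter>j. \<Union>t. ?C j t) = {x. \<exists>y. settles x y}"
  proof (intro equalityI subsetI)
    fix x assume x: "x \<in> (\<Inter>j. \<Union>t. ?C j t)"
    then have "\<forall>j. \<exists>t. x \<in> ?C j t" by blast
    from choice[OF this] obtain p where p: "\<And>j. x \<in> ?C j (p j)" by blast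
    have "settles x (\<lambda>j. x (2 * p j + 1))"
      unfolding settles_def
    proof (intro conjI allI)
      show "0 \<le> level x t" for t using p[of 0] by simp
      show "\<exists>t. level x t = int j \<and> x (2 * t + 1) = x (2 * p j + 1) \<and>
          (\<forall>r>t. int j < level x r)" for j
        using p[of j] by (intro exI[of _ "p j"]) simp
    qed
    then show "x \<in> {x. \<exists>y. settles x y}" by blast
  next
    fix x assume "x \<in> {x. \<exists>y. settles x y}"
    then obtain y where y: "settles x y" by blast
    show "x \<in> (\<Inter>j. \<Union>t. ?C j t)"
    proof (rule INT_I)
      fix j
      obtain t where "level x t = int j" "\<forall>r>t. int j < level x r"
        using y unfolding settles_def by blast
      then have "x \<in> ?C j t" using y by (simp add: settles_def)
      then show "x \<in> (\<Union>t. ?C j t)" by (rule UN_I[OF UNIV_I])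
    qed
  qed
  ultimately show ?thesis by (simp add: numeral_3_eq_3)
qed

lemma Pi0_mono_3:
  assumes "Pi0 3 (A :: omega_word set)" "k \<ge> 3"
  shows "Pi0 k A"
  using Sigma0_mono[of 3 "- A" k] assms by (simp add: Sigma0_Compl)

section \<open>Programs with a prescribed limit\<close>

text \<open>
  Every word is made to denote a program without trace, so that all sequences of words, and not only
  sequences of such programs, can serve as gaps.
\<close>

definition gap :: "word \<Rightarrow> word" where
  "gap w = (if reduces w [] then w else [])"

definition blocks :: "omega_word \<Rightarrow> (nat \<Rightarrow> word) \<Rightarrow> nat \<Rightarrow> word" where
  "blocks y d i = gap (d i) @ [False, y i]"

definition program :: "omega_word \<Rightarrow> (nat \<Rightarrow> word) \<Rightarrow> omega_word" where
  "program y d = omega_concat (blocks y d)"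

lemma blocks_nonempty: "blocks y d i \<noteq> []"
  by (simp add: blocks_def)

lemma program_segment:
  "map (program y d) [cut (blocks y d) i..<cut (blocks y d) (Suc i)] = blocks y d i"
  unfolding program_def by (rule omega_concat_segment[OF blocks_nonempty])

lemma reduces_gap: "reduces (gap w) []"
  by (simp add: gap_def reduces_Nil)

lemma reduces_blocks: "reduces (blocks y d i) [y i]"
  unfolding blocks_def using reduces_append[OF reduces_gap reduces_push] by simp

lemma even_cut_blocks: "even (cut (blocks y d) i)"
proof (induction i)
  case (Suc i)
  then show ?case using reduces_blocks[of y d i] by (simp add: cut_Suc reduces_def)
qed simp

lemma cut_blocks_ge: "i \<le> cut (blocks y d) i"
  by (induction i) (auto simp: cut_Suc blocks_def)

lemma reduces_on_blocks:
  "reduces_on (program y d) (cut (blocks y d) i div 2) (cut (blocks y d) (Suc i) div 2) [y i]"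
proof -
  let ?c = "cut (blocks y d)"
  have "reduces (map (program y d) [2 * (?c i div 2)..<2 * (?c (Suc i) div 2)]) [y i]"
    using program_segment[of y d i] reduces_blocks[of y d i] even_cut_blocks[of y d]
    by (simp only: dvd_mult_div_cancel)
  then show ?thesis
    by (rule iffD1[OF reduces_factor, rotated]) (intro div_le_mono cut_mono le_SucI order_refl)
qed

lemma settles_program: "settles (program y d) y"
proof (rule settles_of_segments)
  show "strict_mono (\<lambda>i::nat. i)" by (simp add: strict_mono_def)
  show "reduces_on (program y d) (cut (blocks y d) i div 2) (cut (blocks y d) (Suc i) div 2)
      (map y [i..<Suc i])" for i
    using reduces_on_blocks by simp
qed simp_all

lemma program_cong:
  assumes "\<And>i. i < m \<Longrightarrow> blocks y d i = blocks z e i" "j < cut (blocks y d) m"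
  shows "program y d j = program z e j"
  using assms
proof (induction m)
  case (Suc m)
  have c: "cut (blocks y d) m = cut (blocks z e) m" "cut (blocks y d) (Suc m) = cut (blocks z e) (Suc m)"
    using Suc.prems(1) by (auto intro!: cut_cong)
  show ?case
  proof (cases "j < cut (blocks y d) m")
    case True
    then show ?thesis using Suc by simp
  next
    case False
    have "map (program y d) [cut (blocks y d) m..<cut (blocks y d) (Suc m)] =
        map (program z e) [cut (blocks y d) m..<cut (blocks y d) (Suc m)]"
      using program_segment[of y d m] program_segment[of z e m] Suc.prems(1)[of m] c by simp
    then show ?thesis using False Suc.prems(2) by (simp add: map_eq_conv del: upt_Suc)
  qed
qed simp

lemma program_continuous:
  "\<exists>m. \<forall>e. map e [0..<m] = map d [0..<m] \<longrightarrow> (\<forall>j<n. program y e j = program y d j)"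
proof (intro exI[of _ n] allI impI)
  fix e j assume e: "map e [0..<n] = map d [0..<n]" and j: "j < n"
  then have "\<And>i. i < n \<Longrightarrow> blocks y d i = blocks y e i"
    by (simp add: blocks_def)
  then show "program y e j = program y d j"
    using program_cong[of n y d y e j] j cut_blocks_ge[of n y d] by simp
qed

text \<open>
  Suppose that the program of \<open>z\<close> and \<open>d\<close> left \<open>F\<close>.  Then it does so within finitely many bits.  The gap
  number \<open>m = length u\<close> of \<open>d\<close> is replaced by the continuation of this program up to these bits,
  followed by what is needed to erase it.  With the new gaps, \<open>y\<close> has a program with the same bits,
  which therefore is not in \<open>F\<close> either, although its gaps begin with \<open>u\<close>.
\<close>

lemma program_forcing_transfer:
  assumes F: "closed F" and yz: "\<And>i. i < length u \<Longrightarrow> z i = y i"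
    and y: "\<And>d. map d [0..<length u] = u \<Longrightarrow> program y d \<in> F"
    and d: "map d [0..<length u] = u"
  shows "program z d \<in> F"
proof (rule ccontr)
  assume "program z d \<notin> F"
  then obtain n where n: "\<And>x. \<forall>i<n. x i = program z d i \<Longrightarrow> x \<notin> F"
    using open_contains_cylinder[OF open_Compl[OF F]] by (metis ComplD ComplI)
  define m where "m = length u"
  define N where "N = max m n"
  let ?c = "cut (blocks z d)"
  have "\<exists>w. reduces_on (program z d) (?c m div 2) (?c (m + k) div 2) w" for k
  proof (induction k)
    case 0
    then show ?case by (intro exI[of _ "[]"]) (simp add: reduces_on_def)
  next
    case (Suc k)
    then show ?case using reduces_on_append reduces_on_blocks[of z d "m + k"] by fastforce
  qed
  then obtain w where "reduces_on (program z d) (?c m div 2) (?c N div 2) w"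
    unfolding N_def by (metis le_add_diff_inverse max.cobounded1)
  then have "reduces (map (program z d) [2 * (?c m div 2)..<2 * (?c N div 2)]) w"
    by (rule iffD2[OF reduces_factor, rotated]) (simp add: N_def div_le_mono cut_mono)
  then have "reduces (map (program z d) [?c m..<?c N]) w"
    using even_cut_blocks by (simp only: dvd_mult_div_cancel)
  then obtain e where e: "reduces (map (program z d) [?c m..<?c N] @ e) []"
    by (rule reduces_erase)
  define d' where "d' = d(m := map (program z d) [?c m..<?c N] @ e)"
  have d'_less: "blocks y d' i = blocks z d i" if "i < m" for i
    using that yz by (simp add: blocks_def d'_def m_def)
  then have cm: "cut (blocks y d') m = ?c m" by (auto intro: cut_cong)
  have new_block: "blocks y d' m = map (program z d) [?c m..<?c N] @ e @ [False, y m]"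
    using e by (simp add: blocks_def d'_def gap_def)
  have seg: "map (program y d') [?c m..<cut (blocks y d') (Suc m)] =
      map (program z d) [?c m..<?c N] @ e @ [False, y m]"
    using program_segment[of y d' m] unfolding cm new_block .
  have "program y d' i = program z d i" if i: "i < n" for i
  proof (cases "i < ?c m")
    case True
    then show ?thesis using program_cong[of m y d' z d i, OF d'_less] cm by simp
  next
    case False
    have "i < ?c N" using i cut_blocks_ge[of N z d] by (simp add: N_def)
    then have lt: "i - ?c m < ?c N - ?c m" using False by simp
    have "cut (blocks y d') (Suc m) - ?c m = ?c N - ?c m + length e + 2"
      using arg_cong[OF seg, of length] by simp
    then have "map (program y d') [?c m..<cut (blocks y d') (Suc m)] ! (i - ?c m) = program y d' i"
      using lt False by (subst nth_map_upt) auto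
    moreover have "(map (program z d) [?c m..<?c N] @ e @ [False, y m]) ! (i - ?c m) = program z d i"
      using lt False by (simp add: nth_append)
    ultimately show ?thesis unfolding seg by simp
  qed
  then have "program y d' \<notin> F" using n by blast
  moreover have "map d' [0..<length u] = u"
    using d unfolding d'_def m_def by (metis (no_types, lifting) atLeastLessThan_iff fun_upd_other less_irrefl map_cong set_upt)
  ultimately show False using y by blast
qed

lemma program_forcing_open:
  assumes "closed F"
  shows "open {y. \<forall>d. map d [0..<length u] = u \<longrightarrow> program y d \<in> F}"
proof (rule open_finitely_determined[where n = "length u"])
  fix y z
  assume "y \<in> {y. \<forall>d. map d [0..<length u] = u \<longrightarrow> program y d \<in> F}" "\<forall>i<length u. z i = y i"
  then show "z \<in> {y. \<forall>d. map d [0..<length u] = u \<longrightarrow> program y d \<in> F}"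
    using program_forcing_transfer[OF assms, of u z y] by blast
qed

lemma Pi0_omega_power_stack_dictionary:
  assumes "k \<ge> 2"
  shows "Pi0 (Suc k) (omega_power {w. stack_dictionary A w}) \<longleftrightarrow> Pi0 k (omega_power {w. A w})"
proof
  assume "Pi0 k (omega_power {w. A w})"
  then obtain C where C: "Pi0 (Suc k) C" "\<And>x y. settles x y \<Longrightarrow> x \<in> C \<longleftrightarrow> y \<in> omega_power {w. A w}"
    using limit_preimage_Pi0 by metis
  have "omega_power {w. stack_dictionary A w} = {x. \<exists>y. settles x y} \<inter> C"
    using C(2) by (auto simp: omega_power_stack_dictionary)
  moreover have "Pi0 (Suc k) {x. \<exists>y. settles x y}"
    using Pi0_mono_3[OF Pi0_3_settles] assms by simp
  ultimately show "Pi0 (Suc k) (omega_power {w. stack_dictionary A w})"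
    using C(1) by (simp add: Pi0_Int)
next
  assume "Pi0 (Suc k) (omega_power {w. stack_dictionary A w})"
  moreover have "program y d \<in> omega_power {w. stack_dictionary A w} \<longleftrightarrow> y \<in> omega_power {w. A w}" for y d
    unfolding omega_power_stack_dictionary using settles_program settles_unique by blast
  ultimately show "Pi0 k (omega_power {w. A w})"
    using Pi0_descent[of program, OF program_continuous program_forcing_open] assms by simp
qed

theorem proposition3p13:
  fixes k :: nat
  assumes "k \<ge> 2"
  shows "\<W> (Pi0 k) \<le>\<^sub>W \<W> (Pi0 (k + 1))"
  unfolding reducible_def
proof (intro exI conjI)
  show "continuous_on UNIV stack_dictionary"
    by (rule continuous_stack_dictionary)
  show "\<W> (Pi0 k) = stack_dictionary -` \<W> (Pi0 (k + 1))"
    using Pi0_omega_power_stack_dictionary[OF assms] by (auto simp: dict_class_def)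
qed

end
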